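(* Let $X$ be a Tychonoff space. If $C_p(X)$ is an $s_{\mathbb{R}}$-space, then $X$ is a realcompact, universal $\sigma$-measure zero space and has the property $(\kappa)$.
   Context: $C_p(X)$ is the space of continuous real-valued functions on $X$ with the topology of pointwise convergence. A function $f:Z\to\mathbb{R}$ is $s$-continuous if its restriction to each convergent sequence in $Z$ (together with its limit) is continuous; $Z$ is an $s_{\mathbb{R}}$-space if every $s$-continuous function $f:Z\to\mathbb{R}$ is continuous. Let $\beta X$ be the Stone–Čech compactification and $P(\beta X)$ the set of regular Borel probability measures on $\beta X$. Put $P_d(X)=\{\mu\in P(\beta X):\mu(A)=1\text{ for some countable }A\subseteq X\}$ and $P_\sigma(X)=\{\mu\in P(\beta X):\mu(K)=0\text{ for every compact }G_\delta\text{-subset }K\text{ of }\beta X\text{ with }K\subseteq\beta X\setminus X\}$. $X$ is universal $\sigma$-measure zero if $P_\sigma(X)=P_d(X)$. Property $(\kappa)$: every pairwise disjoint sequence of finite subsets of $X$ has a strongly point-finite subsequence, where a family $\{A_i\}_{i\in I}$ of subsets of $X$ is strongly point-finite if there are open sets $U_i\supseteq A_i$ such that for every $x\in X$ the set $\{i\in I:x\in U_i\}$ is finite. *)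

theory Defs
  imports "HOL-Analysis.Analysis" "HOL-Probability.Probability_Measure"
begin

definition tychonoff_space :: "'a topology \<Rightarrow> bool" where
  "tychonoff_space X \<longleftrightarrow> completely_regular_space X \<and> Hausdorff_space X"


section \<open>Function spaces and sequential continuity\<close>

text \<open>Points of \<open>Cp X\<close> are the continuous real functions that are \<open>undefined\<close> off \<open>topspace X\<close>
  (as all points of a product topology are), so each function on \<open>X\<close> is represented once.\<close>

definition Cp :: "'a topology \<Rightarrow> ('a \<Rightarrow> real) topology" where
  "Cp X = subtopology (powertop_real (topspace X)) {f. continuous_map X euclideanreal f}"

definition s_continuous :: "'z topology \<Rightarrow> ('z \<Rightarrow> real) \<Rightarrow> bool" where
  "s_continuous Z f \<longleftrightarrow>
     (\<forall>\<sigma> l. range \<sigma> \<subseteq> topspace Z \<and> limitin Z \<sigma> l sequentially \<longrightarrow>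
        continuous_map (subtopology Z (insert l (range \<sigma>))) euclideanreal f)"

definition sR_space :: "'z topology \<Rightarrow> bool" where
  "sR_space Z \<longleftrightarrow> (\<forall>f. s_continuous Z f \<longrightarrow> continuous_map Z euclideanreal f)"


section \<open>Realcompactness\<close>

text \<open>A space is realcompact if it is homeomorphic to a closed subspace of a power of the reals.
  Index sets inside the type \<^typ>\<open>'a \<Rightarrow> real\<close> suffice for a space on \<^typ>\<open>'a\<close>: each coordinate of
  such a homeomorphism is a real function on the space, and a coordinate equal to
  another one can be dropped without losing the embedding or the closedness of its image.\<close>

definition realcompact_space :: "'a topology \<Rightarrow> bool" where
  "realcompact_space X \<longleftrightarrow>
     (\<exists>(I :: ('a \<Rightarrow> real) set) C. closedin (powertop_real I) C \<and>
        X homeomorphic_space subtopology (powertop_real I) C)"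


section \<open>The Stone--Cech compactification\<close>

text \<open>The closure of the image of \<open>X\<close> under the evaluation map into the cube indexed by all
  continuous functions from \<open>X\<close> to the unit interval.\<close>

definition unit_functions :: "'a topology \<Rightarrow> ('a \<Rightarrow> real) set" where
  "unit_functions X = {f \<in> extensional (topspace X). continuous_map X (top_of_set {0..1}) f}"

definition unit_cube :: "'i set \<Rightarrow> ('i \<Rightarrow> real) topology" where
  "unit_cube I = product_topology (\<lambda>i. top_of_set {0..1}) I"

definition beta_emb :: "'a topology \<Rightarrow> 'a \<Rightarrow> ('a \<Rightarrow> real) \<Rightarrow> real" where
  "beta_emb X x = (\<lambda>f \<in> unit_functions X. f x)"

definition stone_cech :: "'a topology \<Rightarrow> (('a \<Rightarrow> real) \<Rightarrow> real) topology" where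
  "stone_cech X =
     (let Q = unit_cube (unit_functions X)
      in subtopology Q (Q closure_of (beta_emb X ` topspace X)))"

lemma compact_space_unit_cube: "compact_space (unit_cube I)"
  unfolding unit_cube_def
  by (simp add: compact_space_product_topology compact_space_subtopology)

lemma Hausdorff_space_unit_cube: "Hausdorff_space (unit_cube I)"
  unfolding unit_cube_def
  using Hausdorff_space_euclidean Hausdorff_space_product_topology Hausdorff_space_subtopology
  by blast

lemma compact_space_stone_cech: "compact_space (stone_cech X)"
  unfolding stone_cech_def Let_def
  by (simp add: closedin_compact_space compact_space_subtopology compact_space_unit_cube)

lemma Hausdorff_space_stone_cech: "Hausdorff_space (stone_cech X)"
  unfolding stone_cech_def Let_def
  by (simp add: Hausdorff_space_subtopology Hausdorff_space_unit_cube)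

lemma unit_functions_eq_mspace:
  "unit_functions X =
     mspace (submetric (cfunspace X euclidean_metric) {f. f \<in> topspace X \<rightarrow> {0..1}})"
proof -
  have "bounded (f ` topspace X)" if "f \<in> topspace X \<rightarrow> {0..1::real}" for f :: "'a \<Rightarrow> real"
    using that by (metis bounded_closed_interval bounded_subset image_subset_iff_funcset)
  then show ?thesis
    by (auto simp: unit_functions_def continuous_map_in_subtopology)
qed

lemma beta_emb_in_cube:
  assumes "x \<in> topspace X"
  shows "beta_emb X x \<in> topspace (unit_cube (unit_functions X))"
  using assms
  by (auto simp: beta_emb_def unit_cube_def unit_functions_def continuous_map_in_subtopology Pi_iff)

lemma beta_emb_in_stone_cech: "beta_emb X ` topspace X \<subseteq> topspace (stone_cech X)"
proof -
  have "beta_emb X ` topspace X \<subseteq> topspace (unit_cube (unit_functions X))"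
    by (rule image_subsetI) (rule beta_emb_in_cube)
  then show ?thesis
    by (simp add: stone_cech_def Let_def closure_of_subset)
qed

lemma embedding_map_beta_emb:
  assumes "tychonoff_space X"
  shows "embedding_map X (stone_cech X) (beta_emb X)"
proof -
  have "embedding_map X (unit_cube (unit_functions X)) (beta_emb X)"
    using completely_regular_space_cube_embedding_explicit[of X] assms
    by (simp add: tychonoff_space_def unit_cube_def unit_functions_eq_mspace beta_emb_def[abs_def])
  then show ?thesis
    using beta_emb_in_stone_cech[of X]
    by (simp add: stone_cech_def Let_def embedding_map_in_subtopology)
qed

lemma dense_beta_emb: "stone_cech X closure_of (beta_emb X ` topspace X) = topspace (stone_cech X)"
proof -
  have "beta_emb X ` topspace X \<subseteq> topspace (unit_cube (unit_functions X))"
    by (rule image_subsetI) (rule beta_emb_in_cube)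
  then show ?thesis
    by (simp add: stone_cech_def Let_def closure_of_subtopology closure_of_subset
        closure_of_subset_topspace Int_absorb1 Int_absorb2 inf.absorb2)
qed

lemma stone_cech_extension:
  fixes f :: "'a \<Rightarrow> real"
  assumes "continuous_map X (top_of_set {0..1}) f"
  obtains g where "continuous_map (stone_cech X) (top_of_set {0..1}) g"
    and "\<And>x. x \<in> topspace X \<Longrightarrow> g (beta_emb X x) = f x"
proof
  let ?f = "restrict f (topspace X)"
  have "continuous_map X (top_of_set {0..1}) ?f"
    using assms by (rule continuous_map_eq) simp
  then have f: "?f \<in> unit_functions X"
    by (simp add: unit_functions_def)
  show "continuous_map (stone_cech X) (top_of_set {0..1}) (\<lambda>p. p ?f)"
    unfolding stone_cech_def Let_def unit_cube_def
    by (intro continuous_map_from_subtopology continuous_map_product_projection f)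
  show "beta_emb X x ?f = f x" if "x \<in> topspace X" for x
    using that f by (simp add: beta_emb_def)
qed


section \<open>Measures on the Stone--Cech compactification\<close>

definition regular_prob :: "'b topology \<Rightarrow> 'b measure set" where
  "regular_prob Y =
     {\<mu>. prob_space \<mu> \<and> sets \<mu> = sets (sigma (topspace Y) {U. openin Y U}) \<and>
        (\<forall>B \<in> sets \<mu>.
           emeasure \<mu> B = (SUP K \<in> {K. compactin Y K \<and> K \<subseteq> B}. emeasure \<mu> K) \<and>
           emeasure \<mu> B = (INF U \<in> {U. openin Y U \<and> B \<subseteq> U}. emeasure \<mu> U))}"

definition P_d :: "'a topology \<Rightarrow> (('a \<Rightarrow> real) \<Rightarrow> real) measure set" where
  "P_d X = {\<mu> \<in> regular_prob (stone_cech X).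
     \<exists>A. countable A \<and> A \<subseteq> beta_emb X ` topspace X \<and> emeasure \<mu> A = 1}"

definition P_sigma :: "'a topology \<Rightarrow> (('a \<Rightarrow> real) \<Rightarrow> real) measure set" where
  "P_sigma X = {\<mu> \<in> regular_prob (stone_cech X).
     \<forall>K. compactin (stone_cech X) K \<and> gdelta_in (stone_cech X) K \<and>
         K \<subseteq> topspace (stone_cech X) - beta_emb X ` topspace X \<longrightarrow> emeasure \<mu> K = 0}"

definition universal_sigma_measure_zero :: "'a topology \<Rightarrow> bool" where
  "universal_sigma_measure_zero X \<longleftrightarrow> P_sigma X = P_d X"


section \<open>Property kappa\<close>

definition strongly_point_finite :: "'a topology \<Rightarrow> 'i set \<Rightarrow> ('i \<Rightarrow> 'a set) \<Rightarrow> bool" where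
  "strongly_point_finite X I A \<longleftrightarrow>
     (\<exists>U. (\<forall>i \<in> I. openin X (U i) \<and> A i \<subseteq> U i) \<and>
          (\<forall>x \<in> topspace X. finite {i \<in> I. x \<in> U i}))"

definition property_kappa :: "'a topology \<Rightarrow> bool" where
  "property_kappa X \<longleftrightarrow>
     (\<forall>F :: nat \<Rightarrow> 'a set.
        (\<forall>n. finite (F n) \<and> F n \<subseteq> topspace X) \<and> disjoint_family F \<longrightarrow>
        (\<exists>r. strict_mono r \<and> strongly_point_finite X (UNIV :: nat set) (F \<circ> r)))"

end

theory Submission
  imports Defs
begin

text \<open>Each conclusion is obtained by feeding a functional \<open>\<Phi>\<close> on \<open>Cp X\<close> to the hypothesis:
  \<open>\<Phi>\<close> is sequentially continuous, hence continuous, hence near the zero function controlled by the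
  values on a finite set \<open>E \<subseteq> X\<close>, and this finite dependence is what the conclusion needs.

  For \<open>(\<kappa>)\<close>, suppose a disjoint sequence \<open>F\<close> of finite sets has no strongly point-finite
  subsequence. A pointwise bounded set of functions meets \<open>{f. f > n on F n}\<close> for finitely many \<open>n\<close>
  only, as otherwise the sets \<open>{f > n}\<close> would be a point-finite open expansion of a
  subsequence. So a sum of bumps \<open>\<phi> n\<close> living on \<open>{f. f > n on F n}\<close> is locally finite along
  convergent sequences, yet unbounded near zero.

  For realcompactness, embed \<open>X\<close> in \<open>\<real>\<^bsup>C(X)\<^esup>\<close> by evaluation. A point \<open>q\<close> in the closure of the image
  agrees with an evaluation on any countable set of functions, so \<open>\<Phi> = q\<close> is sequentially continuous.
  If \<open>q\<close> differs from every evaluation at a point of \<open>E\<close>, a product of functions separating \<open>q\<close> from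
  these vanishes on \<open>E\<close> but not at \<open>q\<close>.

  For \<open>\<mu>\<close> in \<open>P_sigma X\<close>, take \<open>\<Phi> f\<close> to be the \<open>\<mu>\<close>-integral of the extension to \<open>\<beta>X\<close> of \<open>f\<close> truncated
  to \<open>[0,1]\<close>. Pointwise convergence on \<open>X\<close> gives \<open>\<mu>\<close>-almost everywhere convergence on \<open>\<beta>X\<close>, so dominated
  convergence applies. By Urysohn's lemma and regularity the complement of \<open>E\<close> then has
  small measure.\<close>

section \<open>Function spaces\<close>

lemma topspace_Cp:
  "topspace (Cp X) = {f \<in> extensional (topspace X). continuous_map X euclideanreal f}"
  by (auto simp: Cp_def PiE_UNIV_domain PiE_def extensional_def)

lemma openin_Cp:
  "openin (Cp X) S \<longleftrightarrow>
     (\<exists>T. openin (powertop_real (topspace X)) T \<and> S = T \<inter> {f. continuous_map X euclideanreal f})"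
  by (simp add: Cp_def openin_subtopology)

lemma restrict_in_topspace_Cp:
  assumes "continuous_map X euclideanreal f"
  shows "restrict f (topspace X) \<in> topspace (Cp X)"
  using continuous_map_eq[OF assms] by (simp add: topspace_Cp)

lemma Hausdorff_space_Cp: "Hausdorff_space (Cp X)"
  unfolding Cp_def
  by (intro Hausdorff_space_subtopology) (simp add: Hausdorff_space_product_topology)

lemma limitin_Cp_pointwise:
  assumes "limitin (Cp X) \<sigma> l sequentially" and "x \<in> topspace X"
  shows "(\<lambda>n. \<sigma> n x) \<longlonglongrightarrow> l x"
  using assms by (simp add: Cp_def limitin_subtopology limitin_componentwise)

lemma continuous_map_Cp_eval:
  assumes "x \<in> topspace X"
  shows "continuous_map (Cp X) euclideanreal (\<lambda>f. f x)"
  unfolding Cp_def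
  using assms by (intro continuous_map_from_subtopology continuous_map_product_projection)

text \<open>A basic open box around \<open>g\<close> in the product topology constrains only
  finitely many coordinates. These form \<open>E\<close>, and any \<open>f\<close> agreeing with
  \<open>g\<close> there stays in the box.\<close>

lemma continuous_map_Cp_finite_support:
  assumes cont: "continuous_map (Cp X) euclideanreal \<Phi>" and g: "g \<in> topspace (Cp X)" and "e > 0"
  obtains E where "finite E" "E \<subseteq> topspace X"
    "\<And>f. f \<in> topspace (Cp X) \<Longrightarrow> (\<And>x. x \<in> E \<Longrightarrow> f x = g x) \<Longrightarrow> \<bar>\<Phi> f - \<Phi> g\<bar> < e"
proof -
  have "openin (Cp X) {f \<in> topspace (Cp X). \<Phi> f \<in> ball (\<Phi> g) e}"
    by (rule openin_continuous_map_preimage[OF cont]) simp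
  then obtain T where T: "openin (powertop_real (topspace X)) T"
    and eq: "{f \<in> topspace (Cp X). \<Phi> f \<in> ball (\<Phi> g) e} = T \<inter> {f. continuous_map X euclideanreal f}"
    unfolding openin_Cp by blast
  have "g \<in> {f \<in> topspace (Cp X). \<Phi> f \<in> ball (\<Phi> g) e}"
    using g \<open>e > 0\<close> by simp
  then have "g \<in> T"
    unfolding eq by blast
  then obtain U where fin: "finite {i \<in> topspace X. U i \<noteq> topspace euclideanreal}"
    and gU: "g \<in> Pi\<^sub>E (topspace X) U" and UT: "Pi\<^sub>E (topspace X) U \<subseteq> T"
    using T[unfolded openin_product_topology_alt, rule_format, of g] by blast
  show thesis
  proof
    show "finite {i \<in> topspace X. U i \<noteq> topspace euclideanreal}" by (fact fin)
    show "{i \<in> topspace X. U i \<noteq> topspace euclideanreal} \<subseteq> topspace X" by auto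
    fix f assume f: "f \<in> topspace (Cp X)"
      and fg: "\<And>x. x \<in> {i \<in> topspace X. U i \<noteq> topspace euclideanreal} \<Longrightarrow> f x = g x"
    have "f x \<in> U x" if "x \<in> topspace X" for x
      using fg[of x] gU that by (cases "U x = UNIV") (auto simp: PiE_iff)
    then have "f \<in> Pi\<^sub>E (topspace X) U"
      using f by (simp add: PiE_iff topspace_Cp)
    then have "f \<in> T \<inter> {f. continuous_map X euclideanreal f}"
      using UT f by (auto simp: topspace_Cp)
    then have "\<Phi> f \<in> ball (\<Phi> g) e"
      unfolding eq[symmetric] by blast
    then show "\<bar>\<Phi> f - \<Phi> g\<bar> < e"
      by (simp add: dist_real_def abs_minus_commute)
  qed
qed

text \<open>The part of \<open>insert l (range \<sigma>)\<close> sent into a closed \<open>C\<close>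
  is compact if it contains \<open>l\<close>, being some terms of the sequence with their limit.
  Otherwise convergence leaves only finitely many terms in it. Both kinds of set are closed in a
  Hausdorff space.\<close>

lemma sequentially_continuous_imp_s_continuous:
  assumes Z: "Hausdorff_space Z"
    and lim: "\<And>\<sigma> l. range \<sigma> \<subseteq> topspace Z \<Longrightarrow> limitin Z \<sigma> l sequentially \<Longrightarrow> (\<lambda>n. \<Phi> (\<sigma> n)) \<longlonglongrightarrow> \<Phi> l"
  shows "s_continuous Z \<Phi>"
  unfolding s_continuous_def
proof (intro allI impI, elim conjE)
  fix \<sigma> l assume \<sigma>: "range \<sigma> \<subseteq> topspace Z" and l: "limitin Z \<sigma> l sequentially"
  let ?S = "insert l (range \<sigma>)"
  have S: "?S \<subseteq> topspace Z"
    using \<sigma> limitin_topspace[OF l] by auto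
  show "continuous_map (subtopology Z ?S) euclideanreal \<Phi>"
    unfolding continuous_map_closedin_preimage_eq
  proof (intro conjI allI impI)
    fix C :: "real set" assume "closedin euclideanreal C"
    then have C: "open (- C)" by (simp add: open_Compl)
    let ?D = "?S \<inter> \<Phi> -` C"
    have "closedin Z ?D"
    proof (cases "\<Phi> l \<in> C")
      case True
      then have "?D = insert l (range \<sigma> \<inter> \<Phi> -` C)" by auto
      moreover have "compactin Z (insert l (range \<sigma> \<inter> \<Phi> -` C))"
        using \<sigma> by (intro compactin_sequence_with_limit[OF l]) auto
      ultimately show ?thesis
        using compactin_imp_closedin[OF Z] by simp
    next
      case False
      have "eventually (\<lambda>n. \<Phi> (\<sigma> n) \<in> - C) sequentially"
        using topological_tendstoD[OF lim[OF \<sigma> l] C] False by simp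
      then obtain N where N: "\<And>n. n \<ge> N \<Longrightarrow> \<Phi> (\<sigma> n) \<notin> C"
        by (auto simp: eventually_sequentially)
      have "?D \<subseteq> \<sigma> ` {..<N}"
      proof
        fix z assume z: "z \<in> ?D"
        then obtain n where "z = \<sigma> n" using False by auto
        moreover then have "n < N" using N[of n] z by (metis IntE not_less vimageE)
        ultimately show "z \<in> \<sigma> ` {..<N}" by auto
      qed
      then have "finite ?D" by (rule finite_surj[rotated]) simp
      moreover have "?D \<subseteq> topspace Z" using S by auto
      ultimately show ?thesis
        by (intro closedin_Hausdorff_finite[OF Z])
    qed
    then have "closedin (subtopology Z ?S) ?D"
      by (intro closedin_subset_topspace) auto
    then show "closedin (subtopology Z ?S) (topspace (subtopology Z ?S) \<inter> \<Phi> -` C)"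
      unfolding topspace_subtopology_subset[OF S] .
  qed simp
qed

text \<open>Finite sets are compact and, in a Hausdorff space, closed, so complete regularity
  applies to the pair.\<close>

lemma Tychonoff_separate_finite:
  fixes a :: real
  assumes X: "tychonoff_space X" and fin: "finite E" "finite F" "E \<subseteq> topspace X" "F \<subseteq> topspace X"
    and "E \<inter> F = {}" and "a \<ge> 0"
  obtains f where "f \<in> topspace (Cp X)" "\<And>x. x \<in> E \<Longrightarrow> f x = 0" "\<And>x. x \<in> F \<Longrightarrow> f x = a"
proof -
  have H: "completely_regular_space X" "Hausdorff_space X"
    using X by (auto simp: tychonoff_space_def)
  obtain f where f: "continuous_map X (subtopology euclidean {0..a}) f" "f ` E \<subseteq> {0}" "f ` F \<subseteq> {a}"
  proof (rule Urysohn_completely_regular_closed_compact[OF \<open>a \<ge> 0\<close> H(1)])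
    show "closedin X F" using H fin closedin_Hausdorff_finite by blast
    show "compactin X E" using fin finite_imp_compactin by blast
    show "disjnt F E" using \<open>E \<inter> F = {}\<close> by (auto simp: disjnt_def)
  qed
  show thesis
  proof
    show "restrict f (topspace X) \<in> topspace (Cp X)"
      using f(1) by (intro restrict_in_topspace_Cp) (auto simp: continuous_map_in_subtopology)
  qed (use f fin in auto)
qed

section \<open>Property kappa\<close>

lemma sR_property_kappa:
  assumes X: "tychonoff_space X" and sR: "sR_space (Cp X)"
  shows "property_kappa X"
proof (rule ccontr)
  assume "\<not> property_kappa X"
  then obtain F :: "nat \<Rightarrow> 'a set" where fin: "\<And>n. finite (F n)" and sub: "\<And>n. F n \<subseteq> topspace X"
    and disj: "disjoint_family F"
    and bad: "\<And>r. strict_mono r \<Longrightarrow> \<not> strongly_point_finite X (UNIV :: nat set) (F \<circ> r)"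
    unfolding property_kappa_def by blast
  \<comment> \<open>A continuous bump: it is nonzero only if \<open>f > n\<close> on all of
    \<open>F n\<close>, and it reaches its height \<open>n\<close> once \<open>f \<ge> n + 1\<close>
    there.\<close>
  define \<phi> where "\<phi> n f = real n * (\<Prod>x\<in>F n. max 0 (min 1 (f x - real n)))" for n and f :: "'a \<Rightarrow> real"
  have big: "f x > real n" if "\<phi> n f \<noteq> 0" "x \<in> F n" for n f x
  proof (rule ccontr)
    assume "\<not> f x > real n"
    then have "max 0 (min 1 (f x - real n)) = 0" by simp
    then have "(\<Prod>x\<in>F n. max 0 (min 1 (f x - real n))) = 0"
      using that fin[of n] by (intro prod_zero) auto
    then show False using that by (simp add: \<phi>_def)
  qed
  have \<phi>_nonneg: "\<phi> n f \<ge> 0" for n f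
    unfolding \<phi>_def by (intro mult_nonneg_nonneg prod_nonneg) auto
  have \<phi>_cont: "continuous_map (Cp X) euclideanreal (\<phi> n)" for n
  proof -
    have "continuous_map (Cp X) euclideanreal (\<lambda>f. f x)" if "x \<in> F n" for x
      using sub that by (intro continuous_map_Cp_eval) auto
    then show ?thesis
      unfolding \<phi>_def by (intro continuous_intros fin) auto
  qed
  have finite_support: "finite {n. \<exists>f\<in>S. \<phi> n f \<noteq> 0}"
    if S: "S \<subseteq> topspace (Cp X)" and bdd: "\<And>x. x \<in> topspace X \<Longrightarrow> bdd_above ((\<lambda>f. f x) ` S)" for S
  proof (rule ccontr)
    assume "infinite {n. \<exists>f\<in>S. \<phi> n f \<noteq> 0}"
    then obtain r :: "nat \<Rightarrow> nat" where r: "strict_mono r" "\<And>i. r i \<in> {n. \<exists>f\<in>S. \<phi> n f \<noteq> 0}"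
      using infinite_enumerate by blast
    then have "\<forall>i. \<exists>f\<in>S. \<phi> (r i) f \<noteq> 0" by simp
    then obtain h where h: "\<And>i. h i \<in> S" "\<And>i. \<phi> (r i) (h i) \<noteq> 0" by metis
    \<comment> \<open>A point \<open>x\<close> of \<open>U i\<close> satisfies
      \<open>h i x > r i\<close> and \<open>r i \<ge> i\<close>, so a bound for \<open>S\<close> at
      \<open>x\<close> also bounds the indices \<open>i\<close> with
      \<open>x \<in> U i\<close>.\<close>
    define U where "U i = {x \<in> topspace X. h i x \<in> {real (r i)<..}}" for i
    have "strongly_point_finite X (UNIV :: nat set) (F \<circ> r)"
      unfolding strongly_point_finite_def
    proof (intro exI[of _ U] conjI ballI)
      fix i
      have "continuous_map X euclideanreal (h i)"
        using h(1) S by (auto simp: topspace_Cp)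
      then show "openin X (U i)"
        unfolding U_def by (rule openin_continuous_map_preimage) auto
      show "(F \<circ> r) i \<subseteq> U i"
        using big[OF h(2)[of i]] sub[of "r i"] by (auto simp: U_def)
    next
      fix x assume x: "x \<in> topspace X"
      then obtain b where b: "\<And>f. f \<in> S \<Longrightarrow> f x \<le> b"
        using bdd[OF x] by (auto simp: bdd_above_def)
      have "i \<le> nat \<lceil>b\<rceil>" if "x \<in> U i" for i
      proof -
        have "real i \<le> real (r i)" using strict_mono_imp_increasing[OF r(1), of i] by simp
        also have "\<dots> < b" using that b[OF h(1)[of i]] by (simp add: U_def)
        finally show ?thesis by linarith
      qed
      then have "{i \<in> UNIV. x \<in> U i} \<subseteq> {..nat \<lceil>b\<rceil>}" by auto
      then show "finite {i \<in> UNIV. x \<in> U i}"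
        by (rule finite_subset) simp
    qed
    with bad r(1) show False by blast
  qed
  \<comment> \<open>Over an infinite index set the sum would default to 0. For \<open>f\<close> in
    \<open>Cp X\<close> the index set is finite, by \<open>finite_support\<close> applied to
    \<open>{f}\<close>.\<close>
  define \<Phi> where "\<Phi> f = (\<Sum>n | \<phi> n f \<noteq> 0. \<phi> n f)" for f
  have "s_continuous (Cp X) \<Phi>"
    unfolding s_continuous_def
  proof (intro allI impI, elim conjE)
    fix \<sigma> l assume \<sigma>: "range \<sigma> \<subseteq> topspace (Cp X)" and l: "limitin (Cp X) \<sigma> l sequentially"
    let ?S = "insert l (range \<sigma>)"
    let ?N = "{n. \<exists>f\<in>?S. \<phi> n f \<noteq> 0}"
    have S: "?S \<subseteq> topspace (Cp X)"
      using \<sigma> limitin_topspace[OF l] by auto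
    \<comment> \<open>A convergent sequence is pointwise bounded, so one finite index set serves all
      of \<open>?S\<close>, and there \<open>\<Phi>\<close> is a fixed finite sum of continuous
      functions.\<close>
    have N: "finite ?N"
    proof (rule finite_support[OF S])
      fix x assume "x \<in> topspace X"
      then have "(\<lambda>n. \<sigma> n x) \<longlonglongrightarrow> l x"
        by (rule limitin_Cp_pointwise[OF l])
      then have "bounded (range (\<lambda>n. \<sigma> n x))"
        by (rule convergent_imp_bounded)
      then show "bdd_above ((\<lambda>f. f x) ` ?S)"
        by (simp add: image_image bounded_imp_bdd_above)
    qed
    have "continuous_map (Cp X) euclideanreal (\<lambda>f. \<Sum>n\<in>?N. \<phi> n f)"
      by (rule continuous_map_sum[OF N \<phi>_cont])
    then have "continuous_map (subtopology (Cp X) ?S) euclideanreal (\<lambda>f. \<Sum>n\<in>?N. \<phi> n f)"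
      by (rule continuous_map_from_subtopology)
    then show "continuous_map (subtopology (Cp X) ?S) euclideanreal \<Phi>"
    proof (rule continuous_map_eq)
      fix f assume "f \<in> topspace (subtopology (Cp X) ?S)"
      then have "f \<in> ?S" by simp
      then show "(\<Sum>n\<in>?N. \<phi> n f) = \<Phi> f"
        unfolding \<Phi>_def by (intro sum.mono_neutral_right N) auto
    qed
  qed
  then have cont: "continuous_map (Cp X) euclideanreal \<Phi>"
    using sR by (simp add: sR_space_def)
  let ?z = "restrict (\<lambda>_. 0) (topspace X)"
  have z: "?z \<in> topspace (Cp X)"
    by (intro restrict_in_topspace_Cp) simp
  obtain E where E: "finite E" "E \<subseteq> topspace X"
    and near: "\<And>f. f \<in> topspace (Cp X) \<Longrightarrow> (\<And>x. x \<in> E \<Longrightarrow> f x = ?z x) \<Longrightarrow> \<bar>\<Phi> f - \<Phi> ?z\<bar> < 1"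
    using continuous_map_Cp_finite_support[OF cont z zero_less_one] by blast
  \<comment> \<open>By disjointness each point of \<open>E\<close> lies in at most one
    \<open>F n\<close>, which \<open>k\<close> picks out.\<close>
  have "finite {n. F n \<inter> E \<noteq> {}}"
  proof -
    define k where "k x = (SOME n. x \<in> F n)" for x
    have k: "k x = n" if "x \<in> F n" for x n
    proof -
      have "x \<in> F (k x)" unfolding k_def using that by (rule someI)
      with that disj show ?thesis by (auto simp: disjoint_family_on_def)
    qed
    have "{n. F n \<inter> E \<noteq> {}} \<subseteq> k ` E" using k by fastforce
    then show ?thesis by (rule finite_surj[OF E(1)])
  qed
  \<comment> \<open>The index \<open>n\<close> must exceed \<open>\<Phi> ?z + 1\<close>, not just 1:
    an empty \<open>F n\<close> makes \<open>\<phi> n\<close> constantly \<open>n\<close>, so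
    \<open>\<Phi> ?z\<close> need not be 0.\<close>
  then have "finite ({n. F n \<inter> E \<noteq> {}} \<union> {..nat \<lceil>\<Phi> ?z + 1\<rceil>})" by simp
  then obtain n where "n \<notin> {n. F n \<inter> E \<noteq> {}} \<union> {..nat \<lceil>\<Phi> ?z + 1\<rceil>}"
    using ex_new_if_finite[OF infinite_UNIV_nat] by metis
  then have n: "F n \<inter> E = {}" "real n > \<Phi> ?z + 1"
    by (simp_all, linarith)
  \<comment> \<open>The value \<open>n + 1\<close> on \<open>F n\<close> makes every factor of
    \<open>\<phi> n f\<close> equal to 1.\<close>
  obtain f where f: "f \<in> topspace (Cp X)" "\<And>x. x \<in> E \<Longrightarrow> f x = 0" "\<And>x. x \<in> F n \<Longrightarrow> f x = real n + 1"
    using Tychonoff_separate_finite[OF X E(1) fin[of n] E(2) sub[of n], of "real n + 1"] n(1) by auto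
  have "\<phi> n f = real n"
    by (simp add: \<phi>_def f(3))
  moreover have "\<phi> n f \<le> \<Phi> f"
  proof (cases "\<phi> n f = 0")
    case True
    then show ?thesis by (simp add: \<Phi>_def \<phi>_nonneg sum_nonneg)
  next
    case False
    have "finite {n. \<phi> n f \<noteq> 0}"
      using finite_support[of "{f}"] f(1) by simp
    then show ?thesis
      unfolding \<Phi>_def using False \<phi>_nonneg by (intro member_le_sum) auto
  qed
  moreover have "\<bar>\<Phi> f - \<Phi> ?z\<bar> < 1"
    using f E by (intro near) auto
  ultimately show False using n(2) by linarith
qed

section \<open>Realcompactness\<close>

text \<open>The sum over \<open>J\<close> of the coordinate distances to \<open>q\<close> is
  continuous, so a single open neighbourhood of \<open>q\<close> controls all coordinates in
  \<open>J\<close> at once.\<close>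

lemma closure_of_evaluations_approx:
  fixes I :: "('a \<Rightarrow> real) set"
  assumes q: "q \<in> powertop_real I closure_of ((\<lambda>x. \<lambda>f\<in>I. f x) ` S)"
    and J: "finite J" "J \<subseteq> I" and "e > 0"
  obtains x where "x \<in> S" "\<And>f. f \<in> J \<Longrightarrow> \<bar>f x - q f\<bar> < e"
proof -
  let ?D = "\<lambda>p. \<Sum>f\<in>J. \<bar>p f - q f\<bar>"
  let ?T = "{p \<in> topspace (powertop_real I). ?D p \<in> {..<e}}"
  have "continuous_map (powertop_real I) euclideanreal (\<lambda>p. p f)" if "f \<in> J" for f
    using J that by (intro continuous_map_product_projection) auto
  then have "continuous_map (powertop_real I) euclideanreal ?D"
    using J by (intro continuous_intros) auto
  then have "openin (powertop_real I) ?T"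
    by (rule openin_continuous_map_preimage) auto
  moreover have "q \<in> ?T"
    using q \<open>e > 0\<close> by (auto simp: in_closure_of)
  ultimately have "\<exists>p. p \<in> (\<lambda>x. \<lambda>f\<in>I. f x) ` S \<and> p \<in> ?T"
    using q[unfolded in_closure_of, THEN conjunct2, THEN spec, of ?T] by (elim impE) (rule conjI)
  then obtain x where x: "x \<in> S" "?D (\<lambda>f\<in>I. f x) < e"
    by auto
  show thesis
  proof
    fix f assume f: "f \<in> J"
    have "\<bar>(\<lambda>f\<in>I. f x) f - q f\<bar> \<le> ?D (\<lambda>f\<in>I. f x)"
      using J f by (intro member_le_sum) auto
    then show "\<bar>f x - q f\<bar> < e"
      using x f J by (simp add: subset_iff)
  qed (fact x)
qed

text \<open>A closure point \<open>q\<close> need not be an evaluation, but on countably many functions it agrees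
  with one: otherwise the distance from \<open>(h n x)\<close> to \<open>(q (h n))\<close> in \<open>\<real>\<^sup>\<nat>\<close> would be a positive
  continuous function of \<open>x\<close> that takes arbitrarily small values while its reciprocal \<open>k\<close> stays
  near the finite number \<open>q k\<close>.\<close>

lemma closure_of_evaluations_countable:
  assumes q: "q \<in> powertop_real (topspace (Cp X)) closure_of
                     ((\<lambda>x. \<lambda>f\<in>topspace (Cp X). f x) ` topspace X)"
    and h: "\<And>n::nat. h n \<in> topspace (Cp X)"
  shows "\<exists>x\<in>topspace X. \<forall>n. h n x = q (h n)"
proof (rule ccontr)
  assume "\<not> (\<exists>x\<in>topspace X. \<forall>n. h n x = q (h n))"
  then have no: "(\<lambda>n. h n x) \<noteq> (\<lambda>n. q (h n))" if "x \<in> topspace X" for x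
    using that by (simp add: fun_eq_iff)
  define g where "g x = dist (\<lambda>n. h n x) (\<lambda>n. q (h n))" for x
  have gpos: "g x > 0" if "x \<in> topspace X" for x
    using no[OF that] by (simp add: g_def)
  \<comment> \<open>The metric on \<open>nat \<Rightarrow> real\<close> induces the product
    topology, so continuity is checked coordinatewise.\<close>
  have "continuous_map X euclidean (\<lambda>x n. h n x)"
    unfolding euclidean_product_topology[symmetric] continuous_map_componentwise_UNIV
    using h by (simp add: topspace_Cp)
  moreover have "continuous_map euclidean euclideanreal (\<lambda>y. dist y (\<lambda>n. q (h n)))"
    by (simp add: continuous_on_dist)
  ultimately have "continuous_map X euclideanreal ((\<lambda>y. dist y (\<lambda>n. q (h n))) \<circ> (\<lambda>x n. h n x))"
    by (rule continuous_map_compose)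
  then have "continuous_map X euclideanreal g"
    by (simp add: g_def[abs_def] o_def)
  then have "continuous_map X euclideanreal (\<lambda>x. 1 / g x)"
    using gpos by (intro continuous_intros) force+
  then have k: "restrict (\<lambda>x. 1 / g x) (topspace X) \<in> topspace (Cp X)" (is "?k \<in> _")
    by (rule restrict_in_topspace_Cp)
  \<comment> \<open>If \<open>1 / g x\<close> is within 1 of \<open>q ?k\<close>, then
    \<open>g x > \<delta>\<close>. Coordinates up to \<open>N\<close> within
    \<open>\<delta> / 4\<close> contribute at most \<open>\<delta> / 2\<close> to \<open>g x\<close>
    and the tail less than \<open>\<delta> / 2\<close>, which contradicts this.\<close>
  define \<delta> where "\<delta> = 1 / (\<bar>q ?k\<bar> + 1)"
  have \<delta>: "\<delta> > 0" by (simp add: \<delta>_def add_nonneg_pos)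
  obtain N where N: "(1/2) ^ N < \<delta> / 2"
    using real_arch_pow_inv[of "\<delta>/2" "1/2"] \<delta> by auto
  let ?J = "insert ?k (h ` from_nat ` {..N})"
  obtain x where x: "x \<in> topspace X" and J: "\<And>f. f \<in> ?J \<Longrightarrow> \<bar>f x - q f\<bar> < min 1 (\<delta> / 4)"
    using closure_of_evaluations_approx[OF q, of ?J "min 1 (\<delta> / 4)"] h k \<delta> by auto
  have "\<bar>1 / g x - q ?k\<bar> < 1"
    using J[of ?k] x by simp
  then have "1 / g x < \<bar>q ?k\<bar> + 1" by linarith
  then have "\<delta> < g x"
    using gpos[OF x] by (simp add: \<delta>_def field_simps add_nonneg_pos)
  moreover have "Max {dist (h (from_nat n) x) (q (h (from_nat n))) |n. n \<le> N} \<le> \<delta> / 4"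
  proof (rule Max.boundedI)
    fix a assume "a \<in> {dist (h (from_nat n) x) (q (h (from_nat n))) |n. n \<le> N}"
    then obtain n where "n \<le> N" "a = \<bar>h (from_nat n) x - q (h (from_nat n))\<bar>"
      by (auto simp: dist_real_def)
    then show "a \<le> \<delta> / 4" using J[of "h (from_nat n)"] by force
  qed auto
  then have "g x \<le> 2 * (\<delta> / 4) + (1/2) ^ N"
    using dist_fun_le_dist_first_terms[of "\<lambda>n. h n x" "\<lambda>n. q (h n)" N] by (simp add: g_def)
  ultimately show False using N by linarith
qed

text \<open>Injectivity comes from continuous functions separating points, openness onto the image
  from their separating points from closed sets.\<close>

lemma homeomorphic_space_evaluations:
  assumes X: "tychonoff_space X"
  shows "X homeomorphic_space
    subtopology (powertop_real (topspace (Cp X))) ((\<lambda>x. \<lambda>f\<in>topspace (Cp X). f x) ` topspace X)"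
    (is "X homeomorphic_space ?Y")
proof -
  let ?I = "topspace (Cp X)"
  let ?e = "\<lambda>x. \<lambda>f\<in>?I. f x"
  have "?e ` topspace X \<subseteq> topspace (powertop_real ?I)" by auto
  then have topY: "topspace ?Y = ?e ` topspace X"
    by (rule topspace_subtopology_subset)
  have H: "completely_regular_space X" "Hausdorff_space X"
    using X by (auto simp: tychonoff_space_def)
  have "homeomorphic_map X ?Y ?e"
  proof (rule bijective_open_imp_homeomorphic_map)
    show "continuous_map X ?Y ?e"
      by (auto simp: continuous_map_in_subtopology continuous_map_componentwise topspace_Cp)
    show "?e ` topspace X = topspace ?Y" by (rule topY[symmetric])
    show "inj_on ?e (topspace X)"
    proof (rule inj_onI, rule ccontr)
      fix x y assume xy: "x \<in> topspace X" "y \<in> topspace X" "?e x = ?e y" "x \<noteq> y"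
      then obtain f where "f \<in> ?I" "f x = 0" "f y = 1"
        using Tychonoff_separate_finite[OF X, of "{x}" "{y}" 1] by auto
      with fun_cong[OF xy(3), of f] show False by simp
    qed
    show "open_map X ?Y ?e"
      unfolding open_map_def
    proof (intro allI impI)
      fix U assume U: "openin X U"
      show "openin ?Y (?e ` U)"
      proof (subst openin_subopen, intro ballI)
        fix p assume "p \<in> ?e ` U"
        then obtain x where x: "x \<in> U" "p = ?e x" by blast
        have xX: "x \<in> topspace X" using U x openin_subset by blast
        obtain f where f: "continuous_map X (subtopology euclidean {0..1::real}) f"
          "f ` {x} \<subseteq> {0}" "f ` (topspace X - U) \<subseteq> {1}"
          using Urysohn_completely_regular_closed_compact[OF zero_le_one H(1), of "topspace X - U" "{x}"]
            U x xX by auto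
        let ?f = "restrict f (topspace X)"
        have f': "?f \<in> ?I"
          using f(1) by (intro restrict_in_topspace_Cp) (auto simp: continuous_map_in_subtopology)
        \<comment> \<open>Since \<open>f\<close> is 0 at \<open>x\<close> and 1 off
          \<open>U\<close>, bounding the single coordinate \<open>?f\<close> by 1 confines
          evaluations to points of \<open>U\<close>.\<close>
        let ?W = "{p \<in> topspace ?Y. p ?f \<in> {..<1}}"
        have "continuous_map ?Y euclideanreal (\<lambda>p. p ?f)"
          using f' by (intro continuous_map_from_subtopology continuous_map_product_projection)
        then have "openin ?Y ?W"
          by (rule openin_continuous_map_preimage) auto
        moreover have "p \<in> ?W"
          using x xX f f' topY by auto
        moreover have "?W \<subseteq> ?e ` U"
        proof
          fix w assume w: "w \<in> ?W"
          then obtain y where y: "y \<in> topspace X" "w = ?e y" using topY by auto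
          then have "f y < 1" using w f' by simp
          then have "y \<in> U" using f(3) y by force
          then show "w \<in> ?e ` U" using y by blast
        qed
        ultimately show "\<exists>T. openin ?Y T \<and> p \<in> T \<and> T \<subseteq> ?e ` U" by blast
      qed
    qed
  qed
  then show ?thesis by (rule homeomorphic_map_imp_homeomorphic_space)
qed

lemma sR_realcompact:
  assumes X: "tychonoff_space X" and sR: "sR_space (Cp X)"
  shows "realcompact_space X"
proof -
  let ?I = "topspace (Cp X)"
  let ?e = "\<lambda>x. \<lambda>f\<in>?I. f x"
  let ?R = "powertop_real ?I"
  have "q \<in> ?e ` topspace X" if q: "q \<in> ?R closure_of (?e ` topspace X)" for q
  proof (rule ccontr)
    assume nq: "q \<notin> ?e ` topspace X"
    have "s_continuous (Cp X) q"
    proof (rule sequentially_continuous_imp_s_continuous[OF Hausdorff_space_Cp])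
      fix \<sigma> l assume \<sigma>: "range \<sigma> \<subseteq> ?I" and l: "limitin (Cp X) \<sigma> l sequentially"
      have lI: "l \<in> ?I" using limitin_topspace[OF l] .
      \<comment> \<open>The limit, at index 0, and the sequence form one countable family, so a
        single point \<open>x\<close> represents \<open>q\<close> on all of them.\<close>
      have "case_nat l \<sigma> n \<in> ?I" for n
        using \<sigma> lI by (cases n) auto
      from closure_of_evaluations_countable[OF q this]
      obtain x where x: "x \<in> topspace X" "\<forall>n. case_nat l \<sigma> n x = q (case_nat l \<sigma> n)"
        by (rule bexE)
      have "q l = l x" "\<And>n. q (\<sigma> n) = \<sigma> n x"
        using x(2)[THEN spec, of 0] x(2)[THEN spec, of "Suc _"] by simp_all
      then show "(\<lambda>n. q (\<sigma> n)) \<longlonglongrightarrow> q l"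
        using limitin_Cp_pointwise[OF l x(1)] by simp
    qed
    then have cont: "continuous_map (Cp X) euclideanreal q"
      using sR by (simp add: sR_space_def)
    let ?z = "restrict (\<lambda>_. 0) (topspace X)"
    have z: "?z \<in> ?I"
      by (intro restrict_in_topspace_Cp) simp
    obtain E where E: "finite E" "E \<subseteq> topspace X"
      and near: "\<And>f. f \<in> ?I \<Longrightarrow> (\<And>x. x \<in> E \<Longrightarrow> f x = ?z x) \<Longrightarrow> \<bar>q f - q ?z\<bar> < 1"
      using continuous_map_Cp_finite_support[OF cont z zero_less_one] by metis
    have qI: "q \<in> extensional ?I"
      using q by (auto simp: in_closure_of PiE_iff)
    have "\<exists>f\<in>?I. q f \<noteq> f x" if "x \<in> topspace X" for x
    proof (rule ccontr)
      assume "\<not> (\<exists>f\<in>?I. q f \<noteq> f x)"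
      then have "q = ?e x"
        using qI by (intro extensionalityI[of _ ?I]) auto
      with nq that show False by blast
    qed
    then obtain F where F: "\<And>x. x \<in> topspace X \<Longrightarrow> F x \<in> ?I" "\<And>x. x \<in> topspace X \<Longrightarrow> q (F x) \<noteq> F x x"
      by metis
    \<comment> \<open>\<open>c\<close> is the product in \<open>f\<close> with
      \<open>q (F x)\<close> in place of \<open>F x y\<close>. Dividing by it aims at
      \<open>q f = 1\<close>, while the factor for \<open>x\<close> makes \<open>f\<close> vanish at
      each \<open>x\<close> in \<open>E\<close>.\<close>
    define c where "c = (\<Prod>x\<in>E. \<bar>q (F x) - F x x\<bar>)"
    have c: "c \<noteq> 0" using E F by (auto simp: c_def)
    define f where "f = (\<lambda>y\<in>topspace X. (\<Prod>x\<in>E. \<bar>F x y - F x x\<bar>) / c)"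
    have "continuous_map X euclideanreal (F x)" if "x \<in> E" for x
      using F(1) E that by (auto simp: topspace_Cp)
    then have fI: "f \<in> ?I"
      unfolding f_def by (intro restrict_in_topspace_Cp continuous_intros E c) auto
    have f0: "f x = ?z x" if "x \<in> E" for x
    proof -
      have "(\<Prod>y\<in>E. \<bar>F y x - F y y\<bar>) = 0"
        using E that by (intro prod_zero) auto
      then show ?thesis using that E by (auto simp: f_def)
    qed
    \<comment> \<open>Nothing so far says that \<open>q\<close> respects products. On
      \<open>J\<close> it is evaluation at one point, where the formula for \<open>f\<close> can be
      computed.\<close>
    define J where "J = insert ?z (insert f (F ` E))"
    have J: "countable J" "J \<noteq> {}" using E by (auto simp: J_def intro: countable_finite)
    have "J \<subseteq> ?I" using z fI F(1) E by (auto simp: J_def)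
    then have "from_nat_into J n \<in> ?I" for n using from_nat_into[OF J(2)] by blast
    from closure_of_evaluations_countable[OF q this]
    obtain x where x: "x \<in> topspace X" "\<forall>n. from_nat_into J n x = q (from_nat_into J n)"
      by (rule bexE)
    have ev: "q j = j x" if "j \<in> J" for j
      using x(2) from_nat_into_surj[OF J(1) that] by auto
    have "q f = (\<Prod>y\<in>E. \<bar>F y x - F y y\<bar>) / c"
      using ev[of f] x(1) by (simp add: f_def J_def)
    also have "(\<Prod>y\<in>E. \<bar>F y x - F y y\<bar>) = c"
      unfolding c_def by (intro prod.cong) (auto simp: ev J_def)
    finally have "q f = 1" using c by simp
    moreover have "q ?z = 0" using ev[of ?z] x(1) by (simp add: J_def)
    ultimately show False using near[OF fI f0] by simp
  qed
  then have "?R closure_of (?e ` topspace X) \<subseteq> ?e ` topspace X"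
    by (rule subsetI)
  moreover have "?e ` topspace X \<subseteq> topspace ?R" by auto
  ultimately have "closedin ?R (?e ` topspace X)"
    by (intro closure_of_subset_eq[THEN iffD1] conjI)
  then show ?thesis
    unfolding realcompact_space_def using homeomorphic_space_evaluations[OF X]
    by (intro exI conjI)
qed

section \<open>Measures on the Stone--Cech compactification\<close>

lemma regular_prob_space_eq:
  assumes "\<mu> \<in> regular_prob Y"
  shows "space \<mu> = topspace Y"
proof -
  have "sets \<mu> = sets (sigma (topspace Y) {U. openin Y U})"
    using assms by (simp add: regular_prob_def)
  then have "space \<mu> = space (sigma (topspace Y) {U. openin Y U})"
    by (rule sets_eq_imp_space_eq)
  then show ?thesis
    by (simp add: space_measure_of_conv)
qed

lemma regular_prob_openin:
  assumes "\<mu> \<in> regular_prob Y" and "openin Y U"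
  shows "U \<in> sets \<mu>"
proof -
  have "{U. openin Y U} \<subseteq> Pow (topspace Y)"
    using openin_subset by blast
  then show ?thesis
    using assms by (auto simp: regular_prob_def)
qed

lemma regular_prob_closedin:
  assumes "\<mu> \<in> regular_prob Y" and "closedin Y C"
  shows "C \<in> sets \<mu>"
proof -
  have "space \<mu> - (topspace Y - C) \<in> sets \<mu>"
    using assms by (intro sets.compl_sets regular_prob_openin) auto
  moreover have "space \<mu> - (topspace Y - C) = C"
    using closedin_subset[OF assms(2)] by (auto simp: regular_prob_space_eq[OF assms(1)])
  ultimately show ?thesis by simp
qed

lemma regular_prob_countable:
  assumes "\<mu> \<in> regular_prob Y" "Hausdorff_space Y" "countable A" "A \<subseteq> topspace Y"
  shows "A \<in> sets \<mu>"
proof -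
  have "{a} \<in> sets \<mu>" if "a \<in> A" for a
    using assms that
    by (intro regular_prob_closedin[OF assms(1)] closedin_Hausdorff_finite) auto
  then have "(\<Union>a\<in>A. {a}) \<in> sets \<mu>"
    using assms by (intro sets.countable_UN'') auto
  then show ?thesis by simp
qed

lemma regular_prob_measurable:
  fixes g :: "'b \<Rightarrow> real"
  assumes "\<mu> \<in> regular_prob Y" and "continuous_map Y euclideanreal g"
  shows "g \<in> borel_measurable \<mu>"
proof (rule borel_measurableI)
  fix S :: "real set" assume "open S"
  then have "openin Y {y \<in> topspace Y. g y \<in> S}"
    by (intro openin_continuous_map_preimage[OF assms(2)]) simp
  moreover have "{y \<in> topspace Y. g y \<in> S} = g -` S \<inter> space \<mu>"
    by (auto simp: regular_prob_space_eq[OF assms(1)])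
  ultimately show "g -` S \<inter> space \<mu> \<in> sets \<mu>"
    using regular_prob_openin[OF assms(1)] by metis
qed

section \<open>Discrete measures are sigma-additive\<close>

text \<open>A subset of \<open>X\<close> of full measure is disjoint from any \<open>K\<close>
  outside \<open>X\<close>, so \<open>K\<close> is null.\<close>

lemma P_d_subset_P_sigma: "P_d X \<subseteq> P_sigma X"
proof
  fix \<mu> assume "\<mu> \<in> P_d X"
  then obtain A where reg: "\<mu> \<in> regular_prob (stone_cech X)"
    and A: "A \<subseteq> beta_emb X ` topspace X" "emeasure \<mu> A = 1"
    by (auto simp: P_d_def)
  interpret prob_space \<mu>
    using reg by (simp add: regular_prob_def)
  \<comment> \<open>A non-measurable set would have \<open>emeasure\<close> 0 by default, not
    1.\<close>
  have "A \<in> sets \<mu>"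
    using A(2) emeasure_notin_sets by fastforce
  then have AE: "AE p in \<mu>. p \<in> A"
    using A(2) by (simp add: prob_eq_1[symmetric] measure_def)
  have "emeasure \<mu> K = 0"
    if K: "compactin (stone_cech X) K" "K \<subseteq> topspace (stone_cech X) - beta_emb X ` topspace X" for K
  proof -
    have "K \<in> sets \<mu>"
      by (intro regular_prob_closedin[OF reg] compactin_imp_closedin Hausdorff_space_stone_cech K)
    moreover have "AE p in \<mu>. p \<notin> K"
      using AE by (rule eventually_mono) (use A K in auto)
    ultimately show ?thesis by (subst AE_iff_measurable[of K, symmetric]) (auto dest: sets.sets_into_space)
  qed
  then show "\<mu> \<in> P_sigma X"
    using reg by (auto simp: P_sigma_def)
qed

section \<open>From convergence on X to almost everywhere convergence\<close>

text \<open>A closed half-line is the intersection of the open half-lines starting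
  \<open>1 / (j + 1)\<close> below it. This supplies the \<open>gdelta_in\<close> condition in
  \<open>P_sigma\<close>.\<close>

lemma gdelta_in_superlevel:
  fixes u :: "'b \<Rightarrow> real"
  assumes u: "continuous_map Y euclideanreal u"
  shows "gdelta_in Y {p \<in> topspace Y. c \<le> u p}"
proof -
  have "gdelta_in Y (\<Inter>j::nat. {p \<in> topspace Y. u p \<in> {c - 1 / real (Suc j)<..}})"
  proof (intro gdelta_in_Inter)
    have "gdelta_in Y {p \<in> topspace Y. u p \<in> {c - 1 / real (Suc j)<..}}" for j :: nat
      by (intro open_imp_gdelta_in openin_continuous_map_preimage[OF u]) simp
    then show "gdelta_in Y S"
      if "S \<in> range (\<lambda>j::nat. {p \<in> topspace Y. u p \<in> {c - 1 / real (Suc j)<..}})" for S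
      using that by (elim rangeE) (simp only:)
  qed auto
  moreover have "(\<Inter>j::nat. {p \<in> topspace Y. u p \<in> {c - 1 / real (Suc j)<..}})
      = {p \<in> topspace Y. c \<le> u p}"
  proof (intro equalityI subsetI)
    fix p assume "p \<in> (\<Inter>j::nat. {p \<in> topspace Y. u p \<in> {c - 1 / real (Suc j)<..}})"
    then have p: "p \<in> topspace Y" "\<And>j::nat. c - 1 / real (Suc j) < u p" by auto
    have "c \<le> u p"
    proof (rule ccontr)
      assume "\<not> c \<le> u p"
      then obtain j :: nat where "inverse (real (Suc j)) < c - u p"
        using reals_Archimedean[of "c - u p"] by auto
      with p(2)[of j] show False by (simp add: inverse_eq_divide)
    qed
    with p(1) show "p \<in> {p \<in> topspace Y. c \<le> u p}" by simp
  next
    fix p assume p: "p \<in> {p \<in> topspace Y. c \<le> u p}"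
    have "c - 1 / real (Suc j) < u p" for j :: nat
    proof -
      have "0 < 1 / real (Suc j)" by simp
      with p show ?thesis by (simp only: mem_Collect_eq) linarith
    qed
    with p show "p \<in> (\<Inter>j::nat. {p \<in> topspace Y. u p \<in> {c - 1 / real (Suc j)<..}})" by simp
  qed
  ultimately show ?thesis by simp
qed

text \<open>The set where \<open>u n\<close> fails to become small is a Baire set missing \<open>X\<close>. A compact
  \<open>G\<^sub>\<delta>\<close> inside it of nearly full measure comes from cutting each tail union
  \<open>\<Union>n\<ge>N. {u n \<ge> c}\<close> down to a finite one.\<close>

lemma P_sigma_eventually_small:
  fixes u :: "nat \<Rightarrow> _ \<Rightarrow> real"
  assumes \<mu>: "\<mu> \<in> P_sigma X"
    and u: "\<And>n. continuous_map (stone_cech X) euclideanreal (u n)"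
    and small: "\<And>x. x \<in> topspace X \<Longrightarrow> eventually (\<lambda>n. u n (beta_emb X x) < c) sequentially"
  shows "AE p in \<mu>. eventually (\<lambda>n. u n p < c) sequentially"
proof -
  let ?Y = "stone_cech X"
  have reg: "\<mu> \<in> regular_prob ?Y" using \<mu> by (simp add: P_sigma_def)
  interpret prob_space \<mu>
    using reg by (simp add: regular_prob_def)
  define Z where "Z n = {p \<in> topspace ?Y. c \<le> u n p}" for n
  have Zc: "closedin ?Y (Z n)" for n
    using closedin_continuous_map_preimage[OF u[of n], of "{c..}"] by (simp add: Z_def)
  have Zm [measurable]: "Z n \<in> sets \<mu>" for n
    by (rule regular_prob_closedin[OF reg Zc])
  define W where "W N = (\<Union>n\<in>{N..}. Z n)" for N
  define V where "V N M = (\<Union>n\<in>{N..<M}. Z n)" for N M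
  define B where "B = (\<Inter>N. W N)"
  have meas [measurable]: "W N \<in> sets \<mu>" "V N M \<in> sets \<mu>" "B \<in> sets \<mu>" for N M
    unfolding W_def V_def B_def by measurable
  have le: "measure \<mu> B \<le> e" if "e > 0" for e :: real
  proof -
    \<comment> \<open>Continuity from below along \<open>V N M\<close>; the allowed losses,
      \<open>e\<close> times powers of 1/2 starting at the first, add up to
      \<open>e\<close>.\<close>
    have "\<exists>M. measure \<mu> (W N - V N M) \<le> e * (1/2) ^ Suc N" for N
    proof -
      have "incseq (V N)" by (force simp: V_def incseq_def)
      moreover have "(\<Union>M. V N M) = W N"
        by (auto simp: V_def W_def) (meson atLeastLessThan_iff lessI)
      ultimately have "(\<lambda>M. measure \<mu> (V N M)) \<longlonglongrightarrow> measure \<mu> (W N)"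
        using finite_Lim_measure_incseq[of "V N"] meas(2) by (simp add: image_subset_iff)
      moreover have "measure \<mu> (W N) - e * (1/2) ^ Suc N < measure \<mu> (W N)"
        using that by simp
      ultimately have "eventually (\<lambda>M. measure \<mu> (W N) - e * (1/2) ^ Suc N < measure \<mu> (V N M)) sequentially"
        by (rule order_tendstoD)
      then obtain M where "measure \<mu> (W N) - e * (1/2) ^ Suc N < measure \<mu> (V N M)"
        by (auto simp: eventually_sequentially)
      moreover have "V N M \<subseteq> W N" by (auto simp: V_def W_def)
      ultimately have "measure \<mu> (W N - V N M) \<le> e * (1/2) ^ Suc N"
        by (subst finite_measure_Diff) auto
      then show ?thesis ..
    qed
    then obtain M where M: "\<And>N. measure \<mu> (W N - V N (M N)) \<le> e * (1/2) ^ Suc N" by metis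
    define K where "K = (\<Inter>N. V N (M N))"
    have Vc: "closedin ?Y (V N m)" for N m
      unfolding V_def by (intro closedin_Union) (auto intro: Zc)
    have "closedin ?Y K"
      unfolding K_def by (intro closedin_Inter) (auto intro: Vc)
    then have Kc: "compactin ?Y K"
      by (intro closedin_compact_space compact_space_stone_cech)
    have "gdelta_in ?Y (\<Union>n\<in>J. Z n)" if "finite J" for J
      using that
      by induction (auto intro!: gdelta_in_Un gdelta_in_superlevel u simp: Z_def)
    then have "gdelta_in ?Y K"
      unfolding K_def V_def by (intro gdelta_in_Inter) auto
    moreover have "K \<subseteq> topspace ?Y - beta_emb X ` topspace X"
    proof
      fix p assume p: "p \<in> K"
      have "p \<notin> beta_emb X ` topspace X"
      proof
        assume "p \<in> beta_emb X ` topspace X"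
        then obtain x where x: "x \<in> topspace X" "p = beta_emb X x" by blast
        then obtain N where N: "\<And>n. n \<ge> N \<Longrightarrow> u n p < c"
          using small[of x] by (auto simp: eventually_sequentially)
        have "p \<in> V N (M N)" using p by (simp add: K_def)
        then obtain n where "n \<ge> N" "c \<le> u n p" by (auto simp: V_def Z_def)
        with N[of n] show False by simp
      qed
      then show "p \<in> topspace ?Y - beta_emb X ` topspace X"
        using p Kc compactin_subset_topspace by blast
    qed
    ultimately have K0: "emeasure \<mu> K = 0"
      using \<mu> Kc by (simp add: P_sigma_def)
    have Km [measurable]: "K \<in> sets \<mu>" unfolding K_def by measurable
    have "(\<lambda>N. e * ((1/2::real) ^ Suc N)) sums (e * 1)"
      by (intro sums_mult power_half_series)
    then have sums: "summable (\<lambda>N. e * ((1/2::real) ^ Suc N))" "(\<Sum>N. e * ((1/2::real) ^ Suc N)) = e"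
      by (auto simp: sums_iff)
    have summ: "summable (\<lambda>N. measure \<mu> (W N - V N (M N)))"
      using M by (intro summable_comparison_test'[OF sums(1), of 0]) auto
    \<comment> \<open>A point of \<open>B\<close> lies in every \<open>W N\<close>, so it is in
      \<open>K\<close> unless some \<open>V N (M N)\<close> misses it.\<close>
    have "B \<subseteq> K \<union> (\<Union>N. W N - V N (M N))"
      by (auto simp: B_def K_def)
    then have "measure \<mu> B \<le> measure \<mu> (K \<union> (\<Union>N. W N - V N (M N)))"
      by (intro finite_measure_mono) auto
    also have "\<dots> \<le> measure \<mu> K + measure \<mu> (\<Union>N. W N - V N (M N))"
      by (intro measure_Un_le) auto
    also have "measure \<mu> K = 0" using K0 by (simp add: measure_def)
    also have "measure \<mu> (\<Union>N. W N - V N (M N)) \<le> (\<Sum>N. measure \<mu> (W N - V N (M N)))"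
      by (intro finite_measure_subadditive_countably summ) auto
    also have "\<dots> \<le> (\<Sum>N. e * ((1/2::real) ^ Suc N))"
      by (intro suminf_le M summ sums)
    finally show ?thesis using sums by simp
  qed
  have "measure \<mu> B \<le> 0"
    by (rule field_le_epsilon) (simp add: le)
  then have "emeasure \<mu> B = 0"
    by (simp add: emeasure_eq_measure antisym)
  then have "AE p in \<mu>. p \<notin> B"
    by (intro AE_not_in) auto
  then show ?thesis
  proof (rule AE_mp, intro AE_I2 impI)
    fix p assume p: "p \<in> space \<mu>" "p \<notin> B"
    then obtain N where N: "p \<notin> W N" by (auto simp: B_def)
    have "u n p < c" if "n \<ge> N" for n
    proof -
      have "p \<notin> Z n" using N that by (auto simp: W_def)
      then show ?thesis using p by (simp add: Z_def regular_prob_space_eq[OF reg] not_le)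
    qed
    then show "eventually (\<lambda>n. u n p < c) sequentially"
      by (auto simp: eventually_sequentially)
  qed
qed

text \<open>The previous lemma is applied to \<open>\<bar>g n p - h p\<bar>\<close> with thresholds
  \<open>1 / (k + 1)\<close>; countably many null sets are then combined.\<close>

lemma P_sigma_AE_tendsto:
  fixes g :: "nat \<Rightarrow> _ \<Rightarrow> real"
  assumes \<mu>: "\<mu> \<in> P_sigma X"
    and g: "\<And>n. continuous_map (stone_cech X) euclideanreal (g n)"
    and h: "continuous_map (stone_cech X) euclideanreal h"
    and lim: "\<And>x. x \<in> topspace X \<Longrightarrow> (\<lambda>n. g n (beta_emb X x)) \<longlonglongrightarrow> h (beta_emb X x)"
  shows "AE p in \<mu>. (\<lambda>n. g n p) \<longlonglongrightarrow> h p"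
proof -
  have "AE p in \<mu>. eventually (\<lambda>n. \<bar>g n p - h p\<bar> < 1 / real (Suc k)) sequentially" for k
  proof (rule P_sigma_eventually_small[OF \<mu>])
    show "continuous_map (stone_cech X) euclideanreal (\<lambda>p. \<bar>g n p - h p\<bar>)" for n
      by (intro continuous_intros g h)
    show "eventually (\<lambda>n. \<bar>g n (beta_emb X x) - h (beta_emb X x)\<bar> < 1 / real (Suc k)) sequentially"
      if "x \<in> topspace X" for x
      using tendstoD[OF lim[OF that], of "1 / real (Suc k)"] by (simp add: dist_real_def)
  qed
  then have "AE p in \<mu>. \<forall>k. eventually (\<lambda>n. \<bar>g n p - h p\<bar> < 1 / real (Suc k)) sequentially"
    by (simp add: AE_all_countable)
  then show ?thesis
  proof (rule AE_mp, intro AE_I2 impI tendstoI)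
    fix p and e :: real
    assume k: "\<forall>k. eventually (\<lambda>n. \<bar>g n p - h p\<bar> < 1 / real (Suc k)) sequentially" and "e > 0"
    then obtain k where "1 / real (Suc k) < e"
      using reals_Archimedean by (auto simp: inverse_eq_divide)
    then show "eventually (\<lambda>n. dist (g n p) (h p) < e) sequentially"
      using k[THEN spec, of k] by (auto simp: dist_real_def elim!: eventually_mono)
  qed
qed

section \<open>The integral functional and discreteness of the measure\<close>

text \<open>Truncation makes every continuous function extend to the compactification, and it fixes
  functions that already have values in the unit interval.\<close>

definition clamp_unit :: "real \<Rightarrow> real" where
  "clamp_unit t = max 0 (min 1 t)"

lemma clamp_in_unit_functions:
  assumes "f \<in> topspace (Cp X)"
  shows "(\<lambda>x\<in>topspace X. clamp_unit (f x)) \<in> unit_functions X"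
proof -
  have "continuous_map X euclideanreal (\<lambda>x. clamp_unit (f x))"
    unfolding clamp_unit_def using assms by (intro continuous_intros) (auto simp: topspace_Cp)
  then have "continuous_map X euclideanreal (\<lambda>x\<in>topspace X. clamp_unit (f x))"
    by (rule continuous_map_eq) simp
  then show ?thesis
    by (auto simp: unit_functions_def continuous_map_in_subtopology clamp_unit_def)
qed

lemma continuous_map_stone_cech_coordinate:
  assumes "f \<in> unit_functions X"
  shows "continuous_map (stone_cech X) (top_of_set {0..1}) (\<lambda>p. p f)"
  unfolding stone_cech_def Let_def unit_cube_def
  by (intro continuous_map_from_subtopology continuous_map_product_projection assms)

lemma P_sigma_subset_P_d:
  assumes X: "tychonoff_space X" and sR: "sR_space (Cp X)"
  shows "P_sigma X \<subseteq> P_d X"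
proof
  fix \<mu> assume \<mu>: "\<mu> \<in> P_sigma X"
  let ?Y = "stone_cech X"
  have reg: "\<mu> \<in> regular_prob ?Y" using \<mu> by (simp add: P_sigma_def)
  interpret prob_space \<mu>
    using reg by (simp add: regular_prob_def)
  note sp = regular_prob_space_eq[OF reg]
  \<comment> \<open>As \<open>c f\<close> is one of the cube coordinates, \<open>p (c f)\<close> as
    a function of \<open>p\<close> is the extension of the truncated \<open>f\<close>.\<close>
  define c where "c f = (\<lambda>x\<in>topspace X. clamp_unit (f x))" for f :: "'a \<Rightarrow> real"
  have cU: "c f \<in> unit_functions X" if "f \<in> topspace (Cp X)" for f
    using clamp_in_unit_functions[OF that] by (simp add: c_def)
  have coord: "continuous_map ?Y euclideanreal (\<lambda>p. p (c f))" "\<And>p. p \<in> topspace ?Y \<Longrightarrow> p (c f) \<in> {0..1}"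
    if "f \<in> topspace (Cp X)" for f
    using continuous_map_stone_cech_coordinate[OF cU[OF that]]
    by (auto simp: continuous_map_in_subtopology)
  have emb: "beta_emb X x (c f) = clamp_unit (f x)" if "f \<in> topspace (Cp X)" "x \<in> topspace X" for f x
    using cU[OF that(1)] that(2) by (simp add: beta_emb_def c_def)
  have meas: "(\<lambda>p. p (c f)) \<in> borel_measurable \<mu>" if "f \<in> topspace (Cp X)" for f
    by (rule regular_prob_measurable[OF reg coord(1)[OF that]])
  define \<Phi> where "\<Phi> f = (\<integral>p. p (c f) \<partial>\<mu>)" for f
  have "s_continuous (Cp X) \<Phi>"
  proof (rule sequentially_continuous_imp_s_continuous[OF Hausdorff_space_Cp])
    fix \<sigma> l assume \<sigma>: "range \<sigma> \<subseteq> topspace (Cp X)" and l: "limitin (Cp X) \<sigma> l sequentially"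
    have lI: "l \<in> topspace (Cp X)" using limitin_topspace[OF l] .
    have \<sigma>I: "\<sigma> n \<in> topspace (Cp X)" for n using \<sigma> by auto
    have "AE p in \<mu>. (\<lambda>n. p (c (\<sigma> n))) \<longlonglongrightarrow> p (c l)"
    proof (rule P_sigma_AE_tendsto[OF \<mu> coord(1)[OF \<sigma>I] coord(1)[OF lI]])
      fix x assume x: "x \<in> topspace X"
      have "(\<lambda>n. clamp_unit (\<sigma> n x)) \<longlonglongrightarrow> clamp_unit (l x)"
        unfolding clamp_unit_def by (intro tendsto_intros limitin_Cp_pointwise[OF l x])
      then show "(\<lambda>n. beta_emb X x (c (\<sigma> n))) \<longlonglongrightarrow> beta_emb X x (c l)"
        by (simp add: emb lI \<sigma>I x)
    qed
    then show "(\<lambda>n. \<Phi> (\<sigma> n)) \<longlonglongrightarrow> \<Phi> l"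
      unfolding \<Phi>_def
    proof (rule integral_dominated_convergence[where w = "\<lambda>_. 1", rotated 3])
      show "AE p in \<mu>. norm (p (c (\<sigma> n))) \<le> 1" for n
        using coord(2)[OF \<sigma>I] by (intro AE_I2) (auto simp: sp)
    qed (auto intro: meas lI \<sigma>I)
  qed
  then have cont: "continuous_map (Cp X) euclideanreal \<Phi>"
    using sR by (simp add: sR_space_def)
  let ?z = "restrict (\<lambda>_. 0) (topspace X)"
  have z: "?z \<in> topspace (Cp X)"
    by (intro restrict_in_topspace_Cp) simp
  \<comment> \<open>Two continuous real functions that agree on the dense image of \<open>X\<close>
    coincide, so any extension computes the integral.\<close>
  have \<Phi>_eq: "\<Phi> f = (\<integral>p. g p \<partial>\<mu>)"
    if f: "f \<in> topspace (Cp X)" and g: "continuous_map ?Y euclideanreal g"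
      and eq: "\<And>x. x \<in> topspace X \<Longrightarrow> g (beta_emb X x) = clamp_unit (f x)" for f g
  proof -
    have "p (c f) = g p" if p: "p \<in> topspace ?Y" for p
    proof (rule forall_in_closure_of_eq[OF _ Hausdorff_space_euclidean coord(1)[OF f] g])
      show "p \<in> ?Y closure_of (beta_emb X ` topspace X)"
        using p by (simp add: dense_beta_emb)
      show "y (c f) = g y" if "y \<in> beta_emb X ` topspace X" for y
        using that eq emb[OF f] by auto
    qed
    then show ?thesis
      unfolding \<Phi>_def by (intro Bochner_Integration.integral_cong) (auto simp: sp)
  qed
  have small: "\<exists>E. finite E \<and> E \<subseteq> topspace X \<and>
      emeasure \<mu> (topspace ?Y - beta_emb X ` E) \<le> ennreal e" if e: "e > 0" for e :: real
  proof -
    obtain E where E: "finite E" "E \<subseteq> topspace X"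
      and near: "\<And>f. f \<in> topspace (Cp X) \<Longrightarrow> (\<And>x. x \<in> E \<Longrightarrow> f x = ?z x) \<Longrightarrow> \<bar>\<Phi> f - \<Phi> ?z\<bar> < e"
      using continuous_map_Cp_finite_support[OF cont z e] by metis
    let ?bE = "beta_emb X ` E"
    have bE: "closedin ?Y ?bE"
      using E beta_emb_in_stone_cech[of X] Hausdorff_space_stone_cech
      by (intro closedin_Hausdorff_finite) auto
    \<comment> \<open>By inner regularity compact sets suffice. A Urysohn function that is 0 on
      \<open>?bE\<close> and 1 on \<open>K\<close> dominates the indicator of \<open>K\<close>, and
      its restriction to \<open>X\<close> agrees with \<open>?z\<close> on \<open>E\<close>.\<close>
    have "emeasure \<mu> K \<le> ennreal e" if K: "compactin ?Y K" "K \<subseteq> topspace ?Y - ?bE" for K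
    proof -
      have Km: "K \<in> sets \<mu>"
        by (intro regular_prob_closedin[OF reg] compactin_imp_closedin Hausdorff_space_stone_cech K)
      have "normal_space ?Y"
        by (simp add: compact_Hausdorff_or_regular_imp_normal_space compact_space_stone_cech
            Hausdorff_space_stone_cech)
      have "disjnt ?bE K" using K(2) by (auto simp: disjnt_iff)
      then obtain g where g: "continuous_map ?Y (top_of_set {0..1::real}) g" "g ` ?bE \<subseteq> {0}" "g ` K \<subseteq> {1}"
        using Urysohn_lemma[OF \<open>normal_space ?Y\<close> bE
            compactin_imp_closedin[OF Hausdorff_space_stone_cech K(1)] _ zero_le_one]
        by metis
      have gc: "continuous_map ?Y euclideanreal g" and g01: "\<And>p. p \<in> topspace ?Y \<Longrightarrow> g p \<in> {0..1}"
        using g(1) by (auto simp: continuous_map_in_subtopology)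
      let ?f = "\<lambda>x\<in>topspace X. g (beta_emb X x)"
      have "continuous_map X ?Y (beta_emb X)"
        using embedding_map_beta_emb[OF X] homeomorphic_imp_continuous_map
        unfolding embedding_map_def by (blast intro: continuous_map_into_fulltopology)
      then have fI: "?f \<in> topspace (Cp X)"
        using continuous_map_compose[OF _ gc]
        by (intro restrict_in_topspace_Cp) (simp add: o_def)
      have "?f x = ?z x" if "x \<in> E" for x
        using that E g(2) by auto
      then have "\<bar>\<Phi> ?f - \<Phi> ?z\<bar> < e"
        by (rule near[OF fI])
      moreover have "\<Phi> ?z = (\<integral>p. 0 \<partial>\<mu>)"
        by (rule \<Phi>_eq[OF z]) (auto simp: clamp_unit_def)
      moreover have "\<Phi> ?f = (\<integral>p. g p \<partial>\<mu>)"
      proof (rule \<Phi>_eq[OF fI gc])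
        fix x assume x: "x \<in> topspace X"
        then have "g (beta_emb X x) \<in> {0..1}"
          using beta_emb_in_stone_cech[of X] by (intro g01) auto
        then show "g (beta_emb X x) = clamp_unit (?f x)"
          using x by (simp add: clamp_unit_def)
      qed
      moreover have "(\<integral>p. indicator K p \<partial>\<mu>) \<le> (\<integral>p. g p \<partial>\<mu>)"
      proof (rule integral_mono)
        show "integrable \<mu> g"
          using g01 by (intro integrable_const_bound[where B = 1] regular_prob_measurable[OF reg gc] AE_I2)
            (auto simp: sp)
        show "indicator K p \<le> g p" if "p \<in> space \<mu>" for p
          using g01[of p] g(3) that by (auto simp: sp indicator_def)
        show "integrable \<mu> (indicator K :: _ \<Rightarrow> real)"
          by (intro integrable_real_indicator Km) (simp add: emeasure_eq_measure)
      qed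
      ultimately have "measure \<mu> K \<le> e"
        using Km by simp
      then show ?thesis
        by (simp add: emeasure_eq_measure ennreal_leI)
    qed
    moreover have "topspace ?Y - ?bE \<in> sets \<mu>"
      using bE by (intro regular_prob_openin[OF reg]) auto
    ultimately have "emeasure \<mu> (topspace ?Y - ?bE) \<le> ennreal e"
      using reg by (auto simp: regular_prob_def intro: SUP_least)
    then show ?thesis using E by blast
  qed
  have "\<exists>E. finite E \<and> E \<subseteq> topspace X \<and>
      emeasure \<mu> (topspace ?Y - beta_emb X ` E) \<le> ennreal (inverse (real (Suc n)))" for n
    by (rule small) simp
  then obtain E where E: "\<And>n::nat. finite (E n)" "\<And>n. E n \<subseteq> topspace X"
    "\<And>n. emeasure \<mu> (topspace ?Y - beta_emb X ` E n) \<le> ennreal (inverse (real (Suc n)))"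
    by metis
  \<comment> \<open>The finite sets \<open>E n\<close> miss measure at most
    \<open>1 / (n + 1)\<close>, so their union misses none.\<close>
  define A where "A = (\<Union>n. beta_emb X ` E n)"
  have A: "countable A" "A \<subseteq> beta_emb X ` topspace X"
    using E(1,2) by (auto simp: A_def intro: countable_finite)
  have Em: "beta_emb X ` E n \<in> sets \<mu>" for n
  proof (rule regular_prob_countable[OF reg Hausdorff_space_stone_cech])
    show "countable (beta_emb X ` E n)"
      using E(1)[of n] by (simp add: countable_finite)
    show "beta_emb X ` E n \<subseteq> topspace ?Y"
      using E(2)[of n] beta_emb_in_stone_cech[of X] by blast
  qed
  then have Am: "A \<in> sets \<mu>"
    unfolding A_def by (intro sets.countable_UN) auto
  have "measure \<mu> (space \<mu> - A) \<le> inverse (real (Suc n))" for n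
  proof -
    have "measure \<mu> (space \<mu> - A) \<le> measure \<mu> (space \<mu> - beta_emb X ` E n)"
      using Em by (intro finite_measure_mono) (auto simp: A_def)
    also have "\<dots> \<le> inverse (real (Suc n))"
      using E(3)[of n] by (simp add: sp emeasure_eq_measure del: of_nat_Suc)
    finally show ?thesis .
  qed
  then have "measure \<mu> (space \<mu> - A) \<le> 0"
    using LIMSEQ_inverse_real_of_nat by (intro LIMSEQ_le_const) auto
  then have "measure \<mu> A = 1"
    using prob_compl[OF Am] prob_le_1[of A] by linarith
  then show "\<mu> \<in> P_d X"
    using reg A by (auto simp: P_d_def emeasure_eq_measure)
qed

theorem theorem11p18:
  fixes X :: "'a topology"
  assumes "tychonoff_space X"
    and "sR_space (Cp X)"
  shows "realcompact_space X \<and> universal_sigma_measure_zero X \<and> property_kappa X"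
proof (intro conjI)
  show "realcompact_space X"
    using assms by (rule sR_realcompact)
  show "universal_sigma_measure_zero X"
    unfolding universal_sigma_measure_zero_def
    using P_sigma_subset_P_d[OF assms] P_d_subset_P_sigma by (rule equalityI)
  show "property_kappa X"
    using assms by (rule sR_property_kappa)
qed

end
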